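(* Use the setting, notation and semidiscrete systems defined in the context. (1) Let the semidiscretization of the SLV backward Kolmogorov equation be performed by consistent finite difference formulas on the Cartesian grid, giving $U'(t)=A^{(B)}(t)U(t)$ for $0<t\le T$ with initial vector $U(0)$ defined by the payoff of an arbitrary non-path-dependent European option, and let the SLV forward Kolmogorov equation be semidiscretized by the adjoint spatial discretization, giving $\overline P'(\tau)=(A^{(B)}(T-\tau))^{\mathrm T}\,\overline P(\tau)$ with $\overline P(0)$ the $k_0$-th unit vector. Then $$U_{k_0}(T)=\overline P(\tau)^{\mathrm T}U(T-\tau)\qquad\text{for all }0\le\tau\le T,$$ where $k_0$ is the position in the vectorization of the index pair $(i_0,j_0)$ with $(x_{i_0},v_{j_0})=(X_0,V_0)$. Hence the two semidiscretizations define the same approximation for the fair value of non-path-dependent European options. (2) Let in addition the backward and forward Kolmogorov equations of the LV model be semidiscretized in complete correspondence to those of the SLV model, i.e. with the same grid and the same finite difference matrices $D_x,D_{xx}$ in the $x$-direction, giving $U_{LV}'(t)=A^{(B)}_{LV}(t)U_{LV}(t)$ and $\overline P_{LV}'(\tau)=\overline A^{(F)}_{LV}(\tau)\overline P_{LV}(\tau)$. Assume that $$D_{xx}e_x=D_xe_x=0\qquad\text{and}\qquad D_{vv}e_v=D_ve_v=0,$$ that the system $\overline P_{LV}'(\tau)=\overline A^{(F)}_{LV}(\tau)\overline P_{LV}(\tau)$ for $\tau>0$, with $\overline P_{LV}(0)$ the $i_0$-th unit vector, has a unique solution, that for every $\tau>0$ and every $1\le i\le m_1$ both $\sum_{j=1}^{m_2}\overline{\boldsymbol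 P}_{i,j}(\tau)$ and $\sum_{j=1}^{m_2}\psi^2(v_j)\overline{\boldsymbol P}_{i,j}(\tau)$ are strictly positive, and that the leverage function is defined on the grid in the $x$-direction by $$\sigma_{SLV}^2(x_i,\tau)=\sigma_{LV}^2(x_i,\tau)\,\frac{\sum_{j=1}^{m_2}\overline{\boldsymbol P}_{i,j}(\tau)}{\sum_{j=1}^{m_2}\psi^2(v_j)\,\overline{\boldsymbol P}_{i,j}(\tau)}\qquad(1\le i\le m_1,\ \tau>0)$$ (so that $\overline{\boldsymbol P}$ is a solution of the resulting coupled non-linear system). Then $$\overline{\boldsymbol P}(\tau)\,e_v=\overline P_{LV}(\tau)\qquad\text{for all }\tau\ge0.$$ In particular, if the payoff of the non-path-dependent European option with maturity $T$ depends only on the exchange rate $S_T$, so that $U_{LV,i}(0)=\boldsymbol U_{i,j}(0)$ for all $1\le i\le m_1$, $1\le j\le m_2$, then the semidiscretizations of the LV and SLV models define the same approximation for its fair value: $$U_{LV,i_0}(T)=\overline P_{LV}(\tau)^{\mathrm T}U_{LV}(T-\tau)=\overline P(\tau)^{\mathrm T}U(T-\tau)=U_{k_0}(T)\qquad\text{for all }0\le\tau\le T.$$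
   Context: **Models.** $S_\tau>0$ is an exchange rate, $X_\tau=\log(S_\tau/S_0)$. Constants: $r_d,r_f\in\mathbb R$, $\alpha\ge0$, $\kappa,\eta,\xi>0$, $\rho\in[-1,1]$, maturity $T>0$; $\psi$ is a given non-negative function. The stochastic local volatility (SLV) model is $$dX_\tau=(r_d-r_f-\tfrac12\sigma_{SLV}^2(X_\tau,\tau)\psi^2(V_\tau))\,d\tau+\sigma_{SLV}(X_\tau,\tau)\psi(V_\tau)\,dW^{(1)}_\tau,\quad dV_\tau=\kappa(\eta-V_\tau)\,d\tau+\xi V_\tau^\alpha\,dW^{(2)}_\tau,$$ with $dW^{(1)}_\tau\cdot dW^{(2)}_\tau=\rho\,d\tau$; $\sigma_{SLV}(x,\tau)$ is the leverage function. The local volatility (LV) model, with given function $\sigma_{LV}(x,\tau)$, is $$dX_{LV,\tau}=(r_d-r_f-\tfrac12\sigma_{LV}^2(X_{LV,\tau},\tau))\,d\tau+\sigma_{LV}(X_{LV,\tau},\tau)\,dW_\tau.$$ With $t=T-\tau$ the time to maturity, the SLV backward Kolmogorov equation for the non-discounted option value $u(x,v,t)$ is $$u_t=\tfrac12\sigma_{SLV}^2(x,T-t)\psi^2(v)u_{xx}+\rho\xi\sigma_{SLV}(x,T-t)\psi(v)v^\alpha u_{xv}+\tfrac12\xi^2v^{2\alpha}u_{vv}+(r_d-r_f-\tfrac12\sigma_{SLV}^2(x,T-t)\psi^2(v))u_x+\kappa(\eta-v)u_v,$$ and the SLV forward Kolmogorov equation is the formally adjoint equation for the joint density $p(x,v,\tau)$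 of $(X_\tau,V_\tau)$ given $(X_0,V_0)$. The LV backward equation is $\partial_tu_{LV}=\tfrac12\sigma_{LV}^2\partial_{xx}u_{LV}+(r_d-r_f-\tfrac12\sigma_{LV}^2)\partial_xu_{LV}$ (with $\sigma_{LV}$ evaluated at $(x,T-t)$), and the LV forward equation is its formal adjoint, for the density $p_{LV}(x,\tau)$. **Grid.** $x_1<\dots<x_{m_1}$ and $v_1<\dots<v_{m_2}$ are grid points ($v_1=0$ if $\alpha>0$) such that $(x_{i_0},v_{j_0})=(X_0,V_0)$ for some indices $i_0,j_0$. $w_{x,i}>0$ and $w_{v,j}>0$ are quadrature weights (e.g. trapezoidal rule). $e_x\in\mathbb R^{m_1}$ and $e_v\in\mathbb R^{m_2}$ are the all-ones vectors; $I_x,I_v$ are the identity matrices of sizes $m_1,m_2$. $\mathrm{vec}[\cdot]$ stacks the columns of a matrix; $k_0$ is the position of entry $(i_0,j_0)$ in $\mathrm{vec}$ of an $m_1\times m_2$ matrix. $\otimes$ is the Kronecker product. **Finite difference matrices.** $D_x,D_{xx}\in\mathbb R^{m_1\times m_1}$ and $D_v,D_{vv}\in\mathbb R^{m_2\times m_2}$ are the constant matrices representing the chosen consistent finite difference approximations (including the treatment at the boundaries) of the first and second derivatives in the $x$- and $v$-directions. (Consistency, i.e. the truncation error tending to zero under mesh refinement, concerns families of grids; on the fixed grid considered here these are simply given real matrices.) $L(\tau)=\mathrm{diag}(\sigma_{SLV}(x_i,\tau))_{i=1}^{m_1}$, $L_{LV}(\tau)=\mathrm{diag}(\sigma_{LV}(x_i,\tau))_{i=1}^{m_1}$,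 $\Lambda=\mathrm{diag}(v_j)_{j=1}^{m_2}$, and $f(\Lambda)=\mathrm{diag}(f(v_j))$ for a function $f$. **SLV backward semidiscretization.** $\boldsymbol U_{i,j}(t)\approx u(x_i,v_j,t)$, $U(t)=\mathrm{vec}[\boldsymbol U(t)]$, and $U'(t)=A^{(B)}(t)U(t)$ for $0<t\le T$, where $$A^{(B)}(t)=(\rho\xi\psi(\Lambda)\Lambda^\alpha D_v)\otimes(L(T-t)D_x)+\tfrac12\psi^2(\Lambda)\otimes(L^2(T-t)D_{xx})+(r_d-r_f)I_v\otimes D_x-\tfrac12\psi^2(\Lambda)\otimes(L^2(T-t)D_x)+(\tfrac12\xi^2\Lambda^{2\alpha}D_{vv}+\kappa(\eta I_v-\Lambda)D_v)\otimes I_x,$$ and $U(0)$ is given by the values of the payoff at the grid points. The approximation of the non-discounted fair value at the spot is $U_{k_0}(T)=\boldsymbol U_{i_0,j_0}(T)$. **Adjoint spatial discretization (SLV forward).** With $M$ the diagonal matrix whose entry at the position corresponding to $(i,j)$ is $w_{x,i}w_{v,j}$, and $P(\tau)=\mathrm{vec}[\boldsymbol P(\tau)]$, $\boldsymbol P_{i,j}(\tau)\approx p(x_i,v_j,\tau)$, the adjoint discretization is $P'(\tau)=M^{-1}(A^{(B)}(T-\tau))^{\mathrm T}MP(\tau)$. Put $\overline P(\tau)=MP(\tau)=\mathrm{vec}[\overline{\boldsymbol P}(\tau)]$; then $\overline P'(\tau)=(A^{(B)}(T-\tau))^{\mathrm T}\overline P(\tau)$ with $\overline P(0)$ equal to the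 $k_0$-th unit vector. The matrix $(A^{(B)}(T-\tau))^{\mathrm T}$ depends only on $\tau$ (not on $T$), so the system is considered for all $\tau>0$. The forward approximation of the non-discounted fair value at the spot is $\overline P(T)^{\mathrm T}U(0)$. **LV semidiscretizations.** $U_{LV,i}(t)\approx u_{LV}(x_i,t)$, $U_{LV}'(t)=A_{LV}^{(B)}(t)U_{LV}(t)$ for $0<t\le T$ with $$A_{LV}^{(B)}(t)=\tfrac12L_{LV}^2(T-t)D_{xx}+(r_d-r_f)D_x-\tfrac12L_{LV}^2(T-t)D_x,$$ and $U_{LV}(0)$ given by the payoff. The adjoint forward system is $\overline P_{LV}'(\tau)=\overline A_{LV}^{(F)}(\tau)\overline P_{LV}(\tau)$ for $\tau>0$, with $$\overline A_{LV}^{(F)}(\tau)=(A_{LV}^{(B)}(T-\tau))^{\mathrm T}=\tfrac12D_{xx}^{\mathrm T}L_{LV}^2(\tau)+(r_d-r_f)D_x^{\mathrm T}-\tfrac12D_x^{\mathrm T}L_{LV}^2(\tau),$$ and $\overline P_{LV}(0)\in\mathbb R^{m_1}$ the $i_0$-th unit vector (here $\overline P_{LV,i}=w_{x,i}P_{LV,i}$ with $P_{LV,i}(\tau)\approx p_{LV}(x_i,\tau)$). **Solutions.** Solutions of all these ODE systems are understood to exist, to be continuous up to the initial time, and to be differentiable and satisfy the ODE for positive times. *)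

theory Defs
  imports "HOL-Analysis.Analysis"
begin

(* A real matrix with rows indexed by 'm and columns indexed by 'n, that is real ^ 'n ^ 'm without
   the sort constraint "finite", which the notation with ^ would fix as the whole sort of an
   index type that also has to be linearly ordered. *)

type_synonym ('m, 'n) rmatrix = "((real, 'n) vec, 'm) vec"

definition diag_matrix :: "('n \<Rightarrow> real) \<Rightarrow> real ^ 'n ^ 'n"
  where "diag_matrix d = (\<chi> i j. if i = j then d i else 0)"

(* The m1 x m2 unknowns are stacked column by column, so the j-th column precedes the (j+1)-st
   one.  Positions in the stacked vector are therefore indexed by pairs (j, i), column index
   first: in the lexicographic order of the pairs this is the usual numbering
   i + (j - 1) * m1.  The Kronecker product uses the same indexing, the index of the left
   factor being the slow one. *)

definition vec_pos :: "'m1 \<Rightarrow> 'm2 \<Rightarrow> 'm2 \<times> 'm1"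
  where "vec_pos i j = (j, i)"

definition vectorize :: "real ^ 'm2 ^ 'm1 \<Rightarrow> real ^ ('m2 \<times> 'm1)"
  where "vectorize Y = (\<chi> k. Y $ snd k $ fst k)"

definition kronecker ::
    "real ^ 'a ^ 'b \<Rightarrow> real ^ 'c ^ 'd \<Rightarrow> real ^ ('a \<times> 'c) ^ ('b \<times> 'd)"  (infixr "\<otimes>\<^sub>K" 75)
  where "A \<otimes>\<^sub>K B = (\<chi> k l. A $ fst k $ fst l * B $ snd k $ snd l)"

(* Equals 1 for a = 0 and every y, in contrast to powr, for which 0 powr 0 = 0. *)

definition vol_power :: "real \<Rightarrow> real \<Rightarrow> real"
  where "vol_power y a = (if a = 0 then 1 else y powr a)"

(* s0 * exp x is the exchange rate belonging to the log-rate x = ln (s / s0). *)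

definition payoff_on_grid ::
    "(real \<Rightarrow> real \<Rightarrow> real) \<Rightarrow> real \<Rightarrow> ('m1 \<Rightarrow> real) \<Rightarrow> ('m2 \<Rightarrow> real) \<Rightarrow> real ^ 'm2 ^ 'm1"
  where "payoff_on_grid \<phi> s0 x v = (\<chi> i j. \<phi> (s0 * exp (x i)) (v j))"

definition LV_payoff_on_grid :: "(real \<Rightarrow> real) \<Rightarrow> real \<Rightarrow> ('m1 \<Rightarrow> real) \<Rightarrow> real ^ 'm1"
  where "LV_payoff_on_grid \<phi> s0 x = (\<chi> i. \<phi> (s0 * exp (x i)))"

definition SLV_backward_matrix ::
    "real \<Rightarrow> real \<Rightarrow> real \<Rightarrow> real \<Rightarrow> real \<Rightarrow> real \<Rightarrow> real \<Rightarrow> (real \<Rightarrow> real) \<Rightarrow>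
     ('m1 \<Rightarrow> real) \<Rightarrow> ('m2 \<Rightarrow> real) \<Rightarrow>
     real ^ 'm1 ^ 'm1 \<Rightarrow> real ^ 'm1 ^ 'm1 \<Rightarrow> real ^ 'm2 ^ 'm2 \<Rightarrow> real ^ 'm2 ^ 'm2 \<Rightarrow>
     (real \<Rightarrow> real \<Rightarrow> real) \<Rightarrow> real \<Rightarrow> real \<Rightarrow> real ^ ('m2 \<times> 'm1) ^ ('m2 \<times> 'm1)"
  where "SLV_backward_matrix rd rf \<alpha> \<kappa> \<eta> \<xi> \<rho> \<psi> x v Dx Dxx Dv Dvv \<sigma> T t =
    (let L = diag_matrix (\<lambda>i. \<sigma> (x i) (T - t));
         \<Lambda> = diag_matrix v;
         \<Lambda>\<alpha> = diag_matrix (\<lambda>j. vol_power (v j) \<alpha>);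
         \<Lambda>2\<alpha> = diag_matrix (\<lambda>j. vol_power (v j) (2 * \<alpha>));
         \<Psi> = diag_matrix (\<lambda>j. \<psi> (v j));
         \<Psi>2 = diag_matrix (\<lambda>j. (\<psi> (v j))\<^sup>2)
     in ((\<rho> * \<xi>) *\<^sub>R (\<Psi> ** \<Lambda>\<alpha> ** Dv)) \<otimes>\<^sub>K (L ** Dx)
        + ((1 / 2) *\<^sub>R \<Psi>2) \<otimes>\<^sub>K (L ** L ** Dxx)
        + ((rd - rf) *\<^sub>R mat 1) \<otimes>\<^sub>K Dx
        - ((1 / 2) *\<^sub>R \<Psi>2) \<otimes>\<^sub>K (L ** L ** Dx)
        + ((1 / 2 * \<xi>\<^sup>2) *\<^sub>R (\<Lambda>2\<alpha> ** Dvv) + \<kappa> *\<^sub>R ((\<eta> *\<^sub>R mat 1 - \<Lambda>) ** Dv)) \<otimes>\<^sub>K mat 1)"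

definition LV_backward_matrix ::
    "real \<Rightarrow> real \<Rightarrow> ('m1 \<Rightarrow> real) \<Rightarrow> real ^ 'm1 ^ 'm1 \<Rightarrow> real ^ 'm1 ^ 'm1 \<Rightarrow>
     (real \<Rightarrow> real \<Rightarrow> real) \<Rightarrow> real \<Rightarrow> real \<Rightarrow> real ^ 'm1 ^ 'm1"
  where "LV_backward_matrix rd rf x Dx Dxx \<sigma> T t =
    (let L = diag_matrix (\<lambda>i. \<sigma> (x i) (T - t))
     in (1 / 2) *\<^sub>R (L ** L ** Dxx) + (rd - rf) *\<^sub>R Dx - (1 / 2) *\<^sub>R (L ** L ** Dx))"

(* Used with J = {0..T} and J = {0..}: the solution is continuous on J, including time 0, and
   satisfies the equation at the positive times in J (one-sided derivative at T if J = {0..T}). *)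

definition solves_linear_ivp ::
    "real set \<Rightarrow> (real \<Rightarrow> real ^ 'n ^ 'n) \<Rightarrow> real ^ 'n \<Rightarrow> (real \<Rightarrow> real ^ 'n) \<Rightarrow> bool"
  where "solves_linear_ivp J A y0 y \<longleftrightarrow>
    y 0 = y0 \<and> continuous_on J y \<and>
    (\<forall>t\<in>J. 0 < t \<longrightarrow> (y has_vector_derivative A t *v y t) (at t within J))"

definition linear_ivp_uniquely_solvable ::
    "real set \<Rightarrow> (real \<Rightarrow> real ^ 'n ^ 'n) \<Rightarrow> real ^ 'n \<Rightarrow> bool"
  where "linear_ivp_uniquely_solvable J A y0 \<longleftrightarrow>
    (\<exists>y. solves_linear_ivp J A y0 y \<and>
         (\<forall>z. solves_linear_ivp J A y0 z \<longrightarrow> (\<forall>t\<in>J. z t = y t)))"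

end

(* Duality: if y' = A y and p' = A(T - .)^T p, then p \<tau> \<bullet> y (T - \<tau>) has derivative 0, hence is constant;
   this is part (1), and its LV analogue.

   Part (2): the marginal q = Pbar e_v is paired with a test vector w as (e_v \<otimes> w) \<bullet> vec Pbar.  Since
   D_v e_v = D_vv e_v = 0, applying the SLV matrix to e_v \<otimes> w leaves only the x-terms, weighted by
   e_v or by \<psi>^2, and the leverage condition turns \<sigma>_SLV^2 (Pbar \<psi>^2) into \<sigma>_LV^2 q.  So q solves the
   LV forward system and equals PbarLV by uniqueness.  A payoff depending on S only is of the form
   e_v \<otimes> w, so the two option values agree at \<tau> = T, and by duality at all \<tau>. *)

theory Submission
  imports Defs
begin

section \<open>Duality and transfer of linear initial value problems\<close>

lemma inner_transpose_mult:
  fixes A :: "real ^ 'n ^ 'm"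
  shows "w \<bullet> (transpose A *v y) = (A *v w) \<bullet> y"
  by (metis dot_lmul_matrix inner_commute transpose_matrix_vector)

text \<open>Neither equation is required at its own time 0. For the pairing these times are the
  opposite ends \<open>0\<close> and \<open>T\<close>, so the derivative is computed on the open
  interval and continuity covers the ends.\<close>

lemma ivp_adjoint_duality_constant:
  fixes A :: "real \<Rightarrow> real ^ 'n ^ 'n"
  assumes y: "solves_linear_ivp {0..T} A y0 y"
    and p: "solves_linear_ivp {0..} (\<lambda>\<tau>. transpose (A (T - \<tau>))) p0 p"
    and T: "0 < T" and \<tau>: "\<tau> \<in> {0..T}"
  shows "p \<tau> \<bullet> y (T - \<tau>) = p0 \<bullet> y T"
proof -
  let ?g = "\<lambda>s. p s \<bullet> y (T - s)"
  have "continuous_on {0..T} p"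
    using p continuous_on_subset unfolding solves_linear_ivp_def by fastforce
  moreover have "continuous_on {0..T} (\<lambda>s. y (T - s))"
    by (rule continuous_on_compose2[of "{0..T}" y])
      (use y in \<open>auto simp: solves_linear_ivp_def intro!: continuous_intros\<close>)
  ultimately have cont: "continuous_on {0..T} ?g"
    by (rule continuous_on_inner)
  have deriv: "DERIV ?g s :> 0" if s: "0 < s" "s < T" for s
  proof -
    have "(p has_vector_derivative transpose (A (T - s)) *v p s) (at s within {0..})"
      using p s by (auto simp: solves_linear_ivp_def)
    then have dp: "(p has_vector_derivative transpose (A (T - s)) *v p s) (at s)"
      using s at_within_interior[of s "{0..}"] by simp
    have "(y has_vector_derivative A (T - s) *v y (T - s)) (at (T - s) within {0..T})"
      using y s by (auto simp: solves_linear_ivp_def)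
    then have dy: "(y has_vector_derivative A (T - s) *v y (T - s)) (at (T - s))"
      using s at_within_interior[of "T - s" "{0..T}"] by simp
    have "((\<lambda>s. T - s) has_vector_derivative - 1) (at s)"
      by (auto intro!: derivative_eq_intros)
    from vector_diff_chain_at[OF this dy]
    have "((\<lambda>s. y (T - s)) has_vector_derivative - (A (T - s) *v y (T - s))) (at s)"
      by (simp add: o_def)
    with dp have "(?g has_derivative (\<lambda>h. p s \<bullet> (h *\<^sub>R - (A (T - s) *v y (T - s)))
        + (h *\<^sub>R (transpose (A (T - s)) *v p s)) \<bullet> y (T - s))) (at s)"
      unfolding has_vector_derivative_def by (rule has_derivative_inner)
    \<comment> \<open>Time reversal put a minus sign on the first term of the product rule; moving
      the transpose across the inner product makes the two terms cancel.\<close>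
    moreover have "(transpose (A (T - s)) *v p s) \<bullet> y (T - s) = p s \<bullet> (A (T - s) *v y (T - s))"
      by (metis inner_transpose_mult inner_commute)
    ultimately show ?thesis
      by (simp add: has_field_derivative_def lambda_zero)
  qed
  have "?g \<tau> = ?g 0"
    by (rule DERIV_isconst2[OF T cont deriv]) (use \<tau> in auto)
  then show ?thesis
    using p by (simp add: solves_linear_ivp_def)
qed

text \<open>Serves for two changes of unknown: multiplication by \<open>M\<close>, and summation
  over the v-direction. The function \<open>z\<close> is tied to \<open>h\<close> only on
  \<open>J\<close>, because \<open>Pbar\<close> is tied to \<open>P\<close> only at nonnegative
  times.\<close>

lemma solves_linear_ivp_bounded_linear:
  assumes h: "bounded_linear h" and y: "solves_linear_ivp J A y0 y"
    and z: "\<And>t. t \<in> J \<Longrightarrow> z t = h (y t)" and J: "0 \<in> J"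
    and eq: "\<And>t. t \<in> J \<Longrightarrow> 0 < t \<Longrightarrow> h (A t *v y t) = B t *v h (y t)"
  shows "solves_linear_ivp J B (h y0) z"
  unfolding solves_linear_ivp_def
proof (intro conjI ballI impI)
  show "z 0 = h y0"
    using y z J by (simp add: solves_linear_ivp_def)
  have "continuous_on J (\<lambda>t. h (y t))"
    using y bounded_linear.continuous_on[OF h] by (auto simp: solves_linear_ivp_def)
  then show "continuous_on J z"
    using z by (simp cong: continuous_on_cong)
  fix t assume t: "t \<in> J" "0 < t"
  have "((\<lambda>t. h (y t)) has_vector_derivative B t *v z t) (at t within J)"
    using bounded_linear.has_vector_derivative[OF h, of y "A t *v y t" "at t within J"] y t eq z
    by (simp add: solves_linear_ivp_def)
  then show "(z has_vector_derivative B t *v z t) (at t within J)"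
    using has_vector_derivative_transform[OF t(1)] z by metis
qed

section \<open>Diagonal matrices and Kronecker products\<close>

lemma diag_matrix_vector_mult_nth: "(diag_matrix d *v y) $ i = d i * y $ i"
  by (simp add: diag_matrix_def matrix_vector_mult_def if_distrib[where f="\<lambda>a. a * _"] cong: if_cong)

lemma invertible_diag_matrix:
  assumes "\<And>i. d i \<noteq> 0"
  shows "invertible (diag_matrix d)"
proof -
  \<comment> \<open>With \<open>a\<close> and \<open>b\<close> arbitrary, both the left and the
    right inverse law are instances.\<close>
  have "diag_matrix a ** diag_matrix b = mat 1" if "\<And>i. a i * b i = 1" for a b :: "'a \<Rightarrow> real"
    using that by (simp add: matrix_eq vec_eq_iff diag_matrix_vector_mult_nth
      flip: matrix_vector_mul_assoc mult.assoc)
  then show ?thesis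
    unfolding invertible_def using assms by (intro exI[of _ "diag_matrix (\<lambda>i. 1 / d i)"]) simp
qed

text \<open>The Kronecker product of two vectors, with the index of the left factor slow as in
  \<open>kronecker\<close>; it is the vectorization of the rank-one matrix with entries b_i
  a_j.\<close>

definition tensor_vec :: "real ^ 'b \<Rightarrow> real ^ 'd \<Rightarrow> real ^ ('b \<times> 'd)"
  where "tensor_vec a b = (\<chi> k. a $ fst k * b $ snd k)"

text \<open>The mixed-product rule: the double sum over the pair index factors into two sums. It
  lets each summand of the SLV matrix act separately in x and v.\<close>

lemma kronecker_mult_tensor_vec:
  "(A \<otimes>\<^sub>K B) *v tensor_vec a b = tensor_vec (A *v a) (B *v b)"
  by (simp add: vec_eq_iff kronecker_def tensor_vec_def matrix_vector_mult_def sum_product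
      UNIV_Times_UNIV[symmetric] sum.cartesian_product split_beta mult_ac del: UNIV_Times_UNIV)

text \<open>Both sides are the bilinear form of \<open>Y\<close>, summed in different orders.
  Pairing with a product vector thus means averaging over v with weights \<open>a\<close> and then
  pairing in x.\<close>

lemma tensor_vec_inner_vectorize: "tensor_vec a b \<bullet> vectorize Y = b \<bullet> (Y *v a)"
proof -
  have "tensor_vec a b \<bullet> vectorize Y = (\<Sum>j\<in>UNIV. \<Sum>i\<in>UNIV. a $ j * b $ i * Y $ i $ j)"
    by (simp add: inner_vec_def tensor_vec_def vectorize_def
      UNIV_Times_UNIV[symmetric] sum.cartesian_product split_beta del: UNIV_Times_UNIV)
  also have "\<dots> = (\<Sum>i\<in>UNIV. \<Sum>j\<in>UNIV. a $ j * b $ i * Y $ i $ j)"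
    by (rule sum.swap)
  finally show ?thesis
    by (simp add: inner_vec_def matrix_vector_mult_def sum_distrib_left mult_ac)
qed

lemma tensor_vec_scaleR_left: "tensor_vec (c *\<^sub>R a) b = c *\<^sub>R tensor_vec a b"
  by (simp add: vec_eq_iff tensor_vec_def)

lemma tensor_vec_zero_left [simp]: "tensor_vec 0 b = 0"
  by (simp add: vec_eq_iff tensor_vec_def)

lemma vectorize_payoff_on_grid:
  "vectorize (payoff_on_grid (\<lambda>s _. \<phi> s) s0 x v) = tensor_vec (vec 1) (LV_payoff_on_grid \<phi> s0 x)"
  by (simp add: vec_eq_iff vectorize_def payoff_on_grid_def tensor_vec_def LV_payoff_on_grid_def)

section \<open>The marginal in the x-direction of a stacked vector\<close>

definition x_marginal :: "real ^ ('b::finite \<times> 'd::finite) \<Rightarrow> real ^ 'd"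
  where "x_marginal y = (\<chi> i. \<Sum>j\<in>UNIV. y $ (j, i))"

lemma x_marginal_vectorize: "x_marginal (vectorize Y) = Y *v vec 1"
  by (simp add: vec_eq_iff x_marginal_def vectorize_def matrix_vector_mult_def)

text \<open>Taking the marginal is adjoint to extending \<open>w\<close> constantly in v, so a claim
  about the marginal of a transposed matrix can be checked on the matrix itself.\<close>

lemma inner_x_marginal: "w \<bullet> x_marginal y = tensor_vec (vec 1) w \<bullet> y"
proof -
  have "y = vectorize (\<chi> i j. y $ (j, i))"
    by (simp add: vec_eq_iff vectorize_def)
  then show ?thesis
    by (metis x_marginal_vectorize tensor_vec_inner_vectorize)
qed

lemma bounded_linear_x_marginal: "bounded_linear x_marginal"
  by (intro linear_conv_bounded_linear[THEN iffD1] linearI)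
    (simp_all add: vec_eq_iff x_marginal_def sum.distrib sum_distrib_left)

lemma x_marginal_axis: "x_marginal (axis (vec_pos i j) 1) = axis i 1"
  by (auto simp: vec_eq_iff x_marginal_def axis_def vec_pos_def)

section \<open>The SLV and LV matrices on data constant in v\<close>

text \<open>The mixed term and the pure v-terms contain \<open>Dv\<close> or \<open>Dvv\<close>
  acting on the all-ones vector and vanish. The two remaining terms with \<psi> squared share their
  factor in v and combine to the difference of \<open>Dxx\<close> and \<open>Dx\<close>.\<close>

lemma SLV_backward_matrix_tensor_vec:
  assumes "Dvv *v vec 1 = 0" "Dv *v vec 1 = 0"
  shows "SLV_backward_matrix rd rf \<alpha> \<kappa> \<eta> \<xi> \<rho> \<psi> x v Dx Dxx Dv Dvv \<sigma> T t *v tensor_vec (vec 1) w =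
    (1 / 2) *\<^sub>R tensor_vec (\<chi> j. (\<psi> (v j))\<^sup>2) (\<chi> i. (\<sigma> (x i) (T - t))\<^sup>2 * (Dxx *v w - Dx *v w) $ i)
    + (rd - rf) *\<^sub>R tensor_vec (vec 1) (Dx *v w)"
proof -
  have "diag_matrix (\<lambda>j. (\<psi> (v j))\<^sup>2) *v vec 1 = (\<chi> j. (\<psi> (v j))\<^sup>2)"
    by (simp add: vec_eq_iff diag_matrix_vector_mult_nth)
  then show ?thesis
    using assms
    by (simp add: SLV_backward_matrix_def Let_def matrix_vector_mult_add_rdistrib
      matrix_vector_mult_diff_rdistrib kronecker_mult_tensor_vec tensor_vec_scaleR_left
      scaleR_matrix_vector_assoc[symmetric] flip: matrix_vector_mul_assoc)
      (simp add: vec_eq_iff tensor_vec_def diag_matrix_vector_mult_nth algebra_simps power2_eq_square)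
qed

lemma LV_backward_matrix_mult:
  "LV_backward_matrix rd rf x Dx Dxx \<sigma> T t *v w =
    (1 / 2) *\<^sub>R (\<chi> i. (\<sigma> (x i) (T - t))\<^sup>2 * (Dxx *v w - Dx *v w) $ i) + (rd - rf) *\<^sub>R (Dx *v w)"
  by (simp add: LV_backward_matrix_def Let_def matrix_vector_mult_add_rdistrib
      matrix_vector_mult_diff_rdistrib scaleR_matrix_vector_assoc[symmetric]
      flip: matrix_vector_mul_assoc)
    (simp add: vec_eq_iff diag_matrix_vector_mult_nth algebra_simps power2_eq_square)

text \<open>The leverage relation enters with its denominator cleared. It is exactly what matches
  the \<psi>-weighted average over v with the LV coefficient times the plain marginal, row by
  row.\<close>

lemma x_marginal_SLV_forward:
  assumes D: "Dvv *v vec 1 = 0" "Dv *v vec 1 = 0"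
    and leverage: "\<And>i. (\<sigma>SLV (x i) (T - t))\<^sup>2 * (\<Sum>j\<in>UNIV. (\<psi> (v j))\<^sup>2 * Y $ i $ j) =
      (\<sigma>LV (x i) (T - t))\<^sup>2 * (\<Sum>j\<in>UNIV. Y $ i $ j)"
  shows "x_marginal (transpose (SLV_backward_matrix rd rf \<alpha> \<kappa> \<eta> \<xi> \<rho> \<psi> x v Dx Dxx Dv Dvv \<sigma>SLV T t)
      *v vectorize Y) =
    transpose (LV_backward_matrix rd rf x Dx Dxx \<sigma>LV T t) *v x_marginal (vectorize Y)"
    (is "x_marginal (transpose ?A *v _) = transpose ?B *v _")
proof -
  have "w \<bullet> x_marginal (transpose ?A *v vectorize Y) = w \<bullet> (transpose ?B *v x_marginal (vectorize Y))"
    for w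
  proof -
    let ?z = "Dxx *v w - Dx *v w"
    have "(Y *v (\<chi> j. (\<psi> (v j))\<^sup>2)) $ i = (\<Sum>j\<in>UNIV. (\<psi> (v j))\<^sup>2 * Y $ i $ j)"
      and "(Y *v vec 1) $ i = (\<Sum>j\<in>UNIV. Y $ i $ j)" for i
      by (simp_all add: matrix_vector_mult_def mult.commute)
    then have "(\<sigma>SLV (x i) (T - t))\<^sup>2 * ?z $ i * (Y *v (\<chi> j. (\<psi> (v j))\<^sup>2)) $ i =
        (\<sigma>LV (x i) (T - t))\<^sup>2 * ?z $ i * (Y *v vec 1) $ i" for i
      \<comment> \<open>Row \<open>i\<close> of the leverage relation is scaled by the i-th entry of
        \<open>?z\<close>, ready to be summed over \<open>i\<close>.\<close>
      using arg_cong[OF leverage[of i], of "\<lambda>a. ?z $ i * a"] by (simp only: mult_ac)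
    then have "(\<chi> i. (\<sigma>SLV (x i) (T - t))\<^sup>2 * ?z $ i) \<bullet> (Y *v (\<chi> j. (\<psi> (v j))\<^sup>2)) =
        (\<chi> i. (\<sigma>LV (x i) (T - t))\<^sup>2 * ?z $ i) \<bullet> (Y *v vec 1)"
      by (simp only: inner_vec_def vec_lambda_beta inner_real_def)
    then have "(?A *v tensor_vec (vec 1) w) \<bullet> vectorize Y = (?B *v w) \<bullet> (Y *v vec 1)"
      unfolding SLV_backward_matrix_tensor_vec[OF D] LV_backward_matrix_mult
      by (simp add: inner_add_left tensor_vec_inner_vectorize)
    then show ?thesis
      by (simp only: inner_x_marginal x_marginal_vectorize inner_transpose_mult)
  qed
  then show ?thesis
    using vector_eq_ldot by blast
qed

section \<open>Agreement of the option values\<close>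

theorem theorem1:
  fixes rd rf \<alpha> \<kappa> \<eta> \<xi> \<rho> T S0 V0 :: real
    and \<psi> :: "real \<Rightarrow> real"
    and \<sigma>SLV \<sigma>LV :: "real \<Rightarrow> real \<Rightarrow> real"
    and x wx :: "'m1::{finite,linorder} \<Rightarrow> real"
    and v wv :: "'m2::{finite,linorder} \<Rightarrow> real"
    and i0 :: 'm1 and j0 :: 'm2 and k0 :: "'m2 \<times> 'm1"
    and Dx Dxx :: "('m1, 'm1) rmatrix"
    and Dv Dvv :: "('m2, 'm2) rmatrix"
    and M :: "('m2 \<times> 'm1, 'm2 \<times> 'm1) rmatrix"
    and AB :: "real \<Rightarrow> ('m2 \<times> 'm1, 'm2 \<times> 'm1) rmatrix"
    and ABLV AFLV :: "real \<Rightarrow> ('m1, 'm1) rmatrix"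
    and P Pbar :: "real \<Rightarrow> ('m1, 'm2) rmatrix"
  defines "k0 \<equiv> vec_pos i0 j0"
    and "M \<equiv> diag_matrix (\<lambda>(j, i). wx i * wv j)"
    and "AB \<equiv> SLV_backward_matrix rd rf \<alpha> \<kappa> \<eta> \<xi> \<rho> \<psi> x v Dx Dxx Dv Dvv \<sigma>SLV T"
    and "ABLV \<equiv> LV_backward_matrix rd rf x Dx Dxx \<sigma>LV T"
    and "AFLV \<equiv> (\<lambda>\<tau>. transpose (ABLV (T - \<tau>)))"
  assumes "0 \<le> \<alpha>" and "0 < \<kappa>" and "0 < \<eta>" and "0 < \<xi>" and "-1 \<le> \<rho>" and "\<rho> \<le> 1"
    and "0 < T" and "0 < S0"
    and "\<And>j. 0 \<le> \<psi> (v j)"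
    and "strict_mono x" and "strict_mono v"
    and "0 < \<alpha> \<Longrightarrow> v (Min UNIV) = 0"
    and "x i0 = ln (S0 / S0)" and "v j0 = V0"
    and "\<And>i. 0 < wx i" and "\<And>j. 0 < wv j"
    and forward:
      "solves_linear_ivp {0..} (\<lambda>\<tau>. matrix_inv M ** transpose (AB (T - \<tau>)) ** M)
         (matrix_inv M *v axis k0 1) (\<lambda>\<tau>. vectorize (P \<tau>))"
    and Pbar: "\<And>\<tau>. 0 \<le> \<tau> \<Longrightarrow> vectorize (Pbar \<tau>) = M *v vectorize (P \<tau>)"
  shows
    "(\<forall>\<phi> U. solves_linear_ivp {0..T} AB (vectorize (payoff_on_grid \<phi> S0 x v)) (\<lambda>t. vectorize (U t)) \<longrightarrow>
        (\<forall>\<tau>\<in>{0..T}. vectorize (U T) $ k0 = vectorize (Pbar \<tau>) \<bullet> vectorize (U (T - \<tau>))) \<and>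
        vectorize (U T) $ k0 = vectorize (Pbar T) \<bullet> vectorize (U 0))
     \<and>
     (\<forall>PbarLV.
        Dxx *v vec 1 = 0 \<and> Dx *v vec 1 = 0 \<and> Dvv *v vec 1 = 0 \<and> Dv *v vec 1 = 0 \<and>
        linear_ivp_uniquely_solvable {0..} AFLV (axis i0 1) \<and>
        solves_linear_ivp {0..} AFLV (axis i0 1) PbarLV \<and>
        (\<forall>\<tau>>0. \<forall>i. 0 < (\<Sum>j\<in>UNIV. Pbar \<tau> $ i $ j) \<and>
                   0 < (\<Sum>j\<in>UNIV. (\<psi> (v j))\<^sup>2 * Pbar \<tau> $ i $ j)) \<and>
        (\<forall>\<tau>>0. \<forall>i. (\<sigma>SLV (x i) \<tau>)\<^sup>2 =
            (\<sigma>LV (x i) \<tau>)\<^sup>2 * ((\<Sum>j\<in>UNIV. Pbar \<tau> $ i $ j) /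
                                (\<Sum>j\<in>UNIV. (\<psi> (v j))\<^sup>2 * Pbar \<tau> $ i $ j)))
        \<longrightarrow>
        (\<forall>\<tau>\<ge>0. Pbar \<tau> *v vec 1 = PbarLV \<tau>) \<and>
        (\<forall>\<phi> U ULV.
           solves_linear_ivp {0..T} AB (vectorize (payoff_on_grid (\<lambda>s _. \<phi> s) S0 x v)) (\<lambda>t. vectorize (U t)) \<and>
           solves_linear_ivp {0..T} ABLV (LV_payoff_on_grid \<phi> S0 x) ULV \<longrightarrow>
           (\<forall>\<tau>\<in>{0..T}.
              ULV T $ i0 = PbarLV \<tau> \<bullet> ULV (T - \<tau>) \<and>
              PbarLV \<tau> \<bullet> ULV (T - \<tau>) = vectorize (Pbar \<tau>) \<bullet> vectorize (U (T - \<tau>)) \<and>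
              vectorize (Pbar \<tau>) \<bullet> vectorize (U (T - \<tau>)) = vectorize (U T) $ k0)))"
proof -
  have T: "0 < T" by fact
  have "wx i * wv j \<noteq> 0" for i j
    using \<open>\<And>i. 0 < wx i\<close>[of i] \<open>\<And>j. 0 < wv j\<close>[of j] by simp
  then have "invertible M"
    unfolding M_def by (intro invertible_diag_matrix) auto
  then have MM: "M ** matrix_inv M = mat 1"
    unfolding invertible_def matrix_inv_def by (rule someI_ex[THEN conjunct1])
  \<comment> \<open>Multiplying by \<open>M\<close> cancels the leading inverse in the equation for
    \<open>P\<close>, and the trailing \<open>M\<close> turns \<open>P\<close> into
    \<open>Pbar\<close>.\<close>
  have "solves_linear_ivp {0..} (\<lambda>\<tau>. transpose (AB (T - \<tau>))) (M *v (matrix_inv M *v axis k0 1))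
      (\<lambda>\<tau>. vectorize (Pbar \<tau>))"
    by (rule solves_linear_ivp_bounded_linear[OF matrix_vector_mul_bounded_linear forward])
      (simp_all add: Pbar matrix_vector_mul_assoc matrix_mul_assoc MM)
  then have Pbar_ivp: "solves_linear_ivp {0..} (\<lambda>\<tau>. transpose (AB (T - \<tau>))) (axis k0 1)
      (\<lambda>\<tau>. vectorize (Pbar \<tau>))"
    by (simp add: matrix_vector_mul_assoc MM)
  have SLV_duality: "vectorize (Pbar \<tau>) \<bullet> vectorize (U (T - \<tau>)) = vectorize (U T) $ k0"
    if "solves_linear_ivp {0..T} AB y0 (\<lambda>t. vectorize (U t))" "\<tau> \<in> {0..T}" for y0 U \<tau>
    using ivp_adjoint_duality_constant[OF that(1) Pbar_ivp T that(2)] by (simp add: inner_axis')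
  have marginal: "Pbar \<tau> *v vec 1 = PbarLV \<tau>"
    if D: "Dvv *v vec 1 = 0" "Dv *v vec 1 = 0"
      and unique: "linear_ivp_uniquely_solvable {0..} AFLV (axis i0 1)"
      and LV: "solves_linear_ivp {0..} AFLV (axis i0 1) PbarLV"
      and pos: "\<forall>\<tau>>0. \<forall>i. 0 < (\<Sum>j\<in>UNIV. Pbar \<tau> $ i $ j) \<and>
                   0 < (\<Sum>j\<in>UNIV. (\<psi> (v j))\<^sup>2 * Pbar \<tau> $ i $ j)"
      and leverage: "\<forall>\<tau>>0. \<forall>i. (\<sigma>SLV (x i) \<tau>)\<^sup>2 =
            (\<sigma>LV (x i) \<tau>)\<^sup>2 * ((\<Sum>j\<in>UNIV. Pbar \<tau> $ i $ j) /
                                (\<Sum>j\<in>UNIV. (\<psi> (v j))\<^sup>2 * Pbar \<tau> $ i $ j))"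
      and "0 \<le> \<tau>"
    for PbarLV \<tau>
  proof -
    have "x_marginal (transpose (AB (T - s)) *v vectorize (Pbar s)) =
        AFLV s *v x_marginal (vectorize (Pbar s))" if "0 < s" for s
    proof -
      have "(\<sigma>SLV (x i) s)\<^sup>2 * (\<Sum>j\<in>UNIV. (\<psi> (v j))\<^sup>2 * Pbar s $ i $ j) =
          (\<sigma>LV (x i) s)\<^sup>2 * (\<Sum>j\<in>UNIV. Pbar s $ i $ j)" for i
      proof -
        \<comment> \<open>Positivity allows the denominator of the leverage formula to be
          cleared.\<close>
        have "(\<Sum>j\<in>UNIV. (\<psi> (v j))\<^sup>2 * Pbar s $ i $ j) \<noteq> 0"
          using pos that by (metis less_irrefl)
        moreover have "(\<sigma>SLV (x i) s)\<^sup>2 = (\<sigma>LV (x i) s)\<^sup>2 * ((\<Sum>j\<in>UNIV. Pbar s $ i $ j) /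
            (\<Sum>j\<in>UNIV. (\<psi> (v j))\<^sup>2 * Pbar s $ i $ j))"
          using leverage that by blast
        ultimately show ?thesis by simp
      qed
      then show ?thesis
        unfolding AB_def AFLV_def ABLV_def by (intro x_marginal_SLV_forward D) simp
    qed
    \<comment> \<open>The leverage formula holds only for positive times, which is where the ODE is
      required.\<close>
    then have "solves_linear_ivp {0..} AFLV (x_marginal (axis k0 1)) (\<lambda>\<tau>. Pbar \<tau> *v vec 1)"
      by (intro solves_linear_ivp_bounded_linear[OF bounded_linear_x_marginal Pbar_ivp])
        (simp_all add: x_marginal_vectorize)
    then have "solves_linear_ivp {0..} AFLV (axis i0 1) (\<lambda>\<tau>. Pbar \<tau> *v vec 1)"
      by (simp add: k0_def x_marginal_axis)
    with unique LV \<open>0 \<le> \<tau>\<close> show ?thesis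
      unfolding linear_ivp_uniquely_solvable_def by (metis atLeast_iff)
  qed
  show ?thesis
  proof (intro conjI allI impI, goal_cases)
    case (1 \<phi> U)
    then show ?case using SLV_duality by metis
  next
    case (2 \<phi> U)
    then show ?case using SLV_duality[of _ U T] T by simp
  next
    case (3 PbarLV \<tau>)
    then show ?case by (blast intro: marginal)
  next
    case (4 PbarLV \<phi> U ULV)
    \<comment> \<open>The comparison is made at time \<open>T\<close>, where both forward solutions
      are paired with the payoff.\<close>
    then have marg: "Pbar T *v vec 1 = PbarLV T"
      using T less_imp_le by (blast intro: marginal)
    from 4 have U: "solves_linear_ivp {0..T} AB
          (tensor_vec (vec 1) (LV_payoff_on_grid \<phi> S0 x)) (\<lambda>t. vectorize (U t))"
      and ULV: "solves_linear_ivp {0..T} ABLV (LV_payoff_on_grid \<phi> S0 x) ULV"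
      and LV: "solves_linear_ivp {0..} AFLV (axis i0 1) PbarLV"
      by (simp_all add: vectorize_payoff_on_grid)
    have LV_duality: "PbarLV \<tau> \<bullet> ULV (T - \<tau>) = ULV T $ i0" if "\<tau> \<in> {0..T}" for \<tau>
      using ivp_adjoint_duality_constant[OF ULV LV[unfolded AFLV_def] T that] by (simp add: inner_axis')
    \<comment> \<open>A payoff constant in v sees \<open>Pbar T\<close> only through its marginal,
      which is \<open>PbarLV T\<close>.\<close>
    have "PbarLV T \<bullet> ULV 0 = vectorize (Pbar T) \<bullet> vectorize (U 0)"
      using U ULV tensor_vec_inner_vectorize[of "vec 1" "LV_payoff_on_grid \<phi> S0 x" "Pbar T"] marg
      by (simp add: solves_linear_ivp_def inner_commute)
    then have "ULV T $ i0 = vectorize (U T) $ k0"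
      using LV_duality[of T] SLV_duality[OF U, of T] T by simp
    then show ?case
      using LV_duality SLV_duality[OF U] by simp
  qed
qed

end
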